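(* There is a sequence of integers $(t_k)_{k\ge 2}$, with $1\le t_k\le k-1$ for every $k\ge 2$, such that the following holds. Let $\{G_k\}_{k\ge 2}$ be a sequence of graphs, where $G_k$ has a vertex partition $V(G_k)=X_k\cup Y_k$ (with $X_k\cap Y_k=\emptyset$) with $|X_k|=2k-t_k$ and $|Y_k|=2k$. Suppose that, for each $k$, $A_k\subseteq X_k$ is a set of size $t_k$ such that every vertex of $A_k$ has degree $2k$ in $G_k$ and every vertex of $V(G_k)\setminus A_k$ has degree $k$ in $G_k$, and suppose that $e(G_k[X_k])=o(k^2)$ as $k\to\infty$. Then $$\chi_k'(G_k)\ge \left(4-2\sqrt2+o(1)\right)k\qquad\text{as } k\to\infty.$$
   Context: All graphs are finite and simple. For an integer $k\ge 2$, a $\chi_k'$-coloring of a graph $G$ is an edge-coloring (not necessarily proper) such that, for each color, the subgraph spanned by the edges of that color has all nonzero degrees congruent to $1\pmod k$. The mod $k$ chromatic index $\chi_k'(G)$ is the minimum number of colors in a $\chi_k'$-coloring of $G$. For $S\subseteq V(G)$, $G[S]$ is the subgraph induced by $S$, and $e(H)$ denotes the number of edges of a graph $H$. The sets $X_k$ and $Y_k$ need not be independent. The conclusion means that there is a sequence $\varepsilon_k\to0$ with $\chi_k'(G_k)\ge(4-2\sqrt2+\varepsilon_k)k$ for all $k\geq 2$. *)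

theory Defs
  imports Complex_Main "HOL-Library.Landau_Symbols" "HOL-Number_Theory.Cong"
begin

record 'a ugraph =
  verts :: "'a set"
  edges :: "'a set set"

definition simple_graph :: "'a ugraph \<Rightarrow> bool" where
  "simple_graph G \<longleftrightarrow>
     finite (verts G) \<and> (\<forall>e\<in>edges G. e \<subseteq> verts G \<and> card e = 2)"

definition vertex_degree :: "'a ugraph \<Rightarrow> 'a \<Rightarrow> nat" where
  "vertex_degree G v = card {e \<in> edges G. v \<in> e}"

definition induced_subgraph :: "'a ugraph \<Rightarrow> 'a set \<Rightarrow> 'a ugraph" where
  "induced_subgraph G S = \<lparr>verts = S, edges = {e \<in> edges G. e \<subseteq> S}\<rparr>"

definition num_edges :: "'a ugraph \<Rightarrow> nat" where
  "num_edges G = card (edges G)"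

(* All vertices of G are kept; the additional isolated vertices have degree 0 and are
   therefore irrelevant to the condition on nonzero degrees below. *)
definition color_class :: "'a ugraph \<Rightarrow> ('a set \<Rightarrow> nat) \<Rightarrow> nat \<Rightarrow> 'a ugraph" where
  "color_class G c i = \<lparr>verts = verts G, edges = {e \<in> edges G. c e = i}\<rparr>"

definition mod_coloring :: "nat \<Rightarrow> 'a ugraph \<Rightarrow> ('a set \<Rightarrow> nat) \<Rightarrow> bool" where
  "mod_coloring k G c \<longleftrightarrow>
     (\<forall>i. \<forall>v\<in>verts G. vertex_degree (color_class G c i) v \<noteq> 0 \<longrightarrow>
        [vertex_degree (color_class G c i) v = 1] (mod k))"

(* For a finite simple graph the minimum is over a nonempty set: giving all edges distinct
   colors yields color classes whose nonzero degrees are all 1. *)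
definition mod_chromatic_index :: "nat \<Rightarrow> 'a ugraph \<Rightarrow> nat" where
  "mod_chromatic_index k G =
     (LEAST m. \<exists>c. mod_coloring k G c \<and> card (c ` edges G) = m)"

end

theory Submission imports Defs begin

text \<open>
  The bound comes from counting the edges between \<open>X\<close> and \<open>Y\<close> colour by colour.  A vertex of
  degree at most \<open>k\<close> sees every colour at most once, and a vertex of degree at most \<open>2 k + 1\<close> sees
  at most one colour more than once, since a repeated colour occupies at least \<open>k + 1\<close> of its
  edges.  So at most \<open>\<bar>A\<bar> = t\<close> colours are repeated at some vertex of \<open>A\<close>.  Each of these colours
  has at most \<open>\<bar>Y\<bar> = 2 k\<close> edges between \<open>X\<close> and \<open>Y\<close>, because it is never repeated in \<open>Y\<close>; every other
  colour has at most \<open>\<bar>X\<bar> = 2 k - t\<close>, because it is not repeated in \<open>X\<close> either.  The degrees in \<open>X\<close>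
  sum to \<open>2 k\<^sup>2\<close>, so there are at least \<open>2 k\<^sup>2 - 2 e(G[X])\<close> edges between \<open>X\<close> and \<open>Y\<close>, and with
  \<open>m\<close> colours
  \<open>2 k\<^sup>2 - 2 e(G[X]) \<le> m (2 k - t) + t\<^sup>2\<close>.
  For \<open>t \<approx> \<tau> k\<close> and \<open>e(G[X]) = o(k\<^sup>2)\<close> this reads \<open>m \<ge> ((2 - \<tau>\<^sup>2) / (2 - \<tau>) + o(1)) k\<close>.  On \<open>[0, 1]\<close> the
  quotient is largest where \<open>\<tau>\<^sup>2 - 4 \<tau> + 2 = 0\<close>, that is at \<open>\<tau> = 2 - sqrt 2\<close>, and its value there
  is \<open>4 - 2 sqrt 2\<close>; this dictates the choice \<open>t\<^sub>k = \<lfloor>(2 - sqrt 2) k\<rfloor>\<close>.  The combinatorial estimate is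
  \<open>degree_sum_le_colors\<close>, the asymptotic one \<open>color_ratio_tendsto\<close>.
\<close>

section \<open>Edge counts\<close>

lemma simple_graph_finite_edges:
  assumes "simple_graph G" shows "finite (edges G)"
  using assms unfolding simple_graph_def
  by (meson PowI finite_Pow_iff finite_subset subsetI)

lemma card_le_of_meets:
  fixes F :: "'a set set"
  assumes fin: "finite S"
    and meets: "\<And>e. e \<in> F \<Longrightarrow> e \<inter> S \<noteq> {}"
    and le1: "\<And>v. v \<in> S \<Longrightarrow> card {e \<in> F. v \<in> e} \<le> 1"
  shows "card F \<le> card S"
proof -
  have "F = (\<Union>v\<in>S. {e \<in> F. v \<in> e})" using meets by blast
  then have "card F \<le> (\<Sum>v\<in>S. card {e \<in> F. v \<in> e})"
    using card_UN_le[OF fin, of "\<lambda>v. {e \<in> F. v \<in> e}"] by simp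
  also have "\<dots> \<le> (\<Sum>v\<in>S. 1)" using le1 by (rule sum_mono)
  finally show ?thesis by simp
qed

text \<open>
  Handshake counting on \<open>X\<close>: an edge inside \<open>X\<close> is counted twice, an edge that leaves \<open>X\<close> once.
\<close>

lemma degree_sum_le:
  assumes G: "simple_graph G" and X: "X \<subseteq> verts G"
  shows "(\<Sum>v\<in>X. vertex_degree G v) \<le> 
    2 * num_edges (induced_subgraph G X) + card {e \<in> edges G. e \<inter> X \<noteq> {} \<and> \<not> e \<subseteq> X}"
proof -
  have fE: "finite (edges G)" using simple_graph_finite_edges[OF G] .
  have fX: "finite X" using G X finite_subset unfolding simple_graph_def by blast
  let ?in = "\<lambda>e. e \<subseteq> X" and ?out = "\<lambda>e. e \<inter> X \<noteq> {} \<and> \<not> e \<subseteq> X"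
  have per_edge: "card (e \<inter> X) \<le> 2 * of_bool (?in e) + of_bool (?out e)" if "e \<in> edges G" for e
  proof -
    have c2: "card e = 2" using G that unfolding simple_graph_def by blast
    then have fe: "finite e" using card.infinite by fastforce
    have "card (e \<inter> X) < card e" if "\<not> e \<subseteq> X"
      using that fe by (intro psubset_card_mono) auto
    then show ?thesis using c2 by (cases "e \<subseteq> X"; cases "e \<inter> X = {}") (auto simp: Int_absorb2)
  qed
  have "(\<Sum>v\<in>X. vertex_degree G v) = (\<Sum>v\<in>X. \<Sum>e\<in>edges G. of_bool (v \<in> e))"
    unfolding vertex_degree_def using fE by (simp add: Int_def)
  also have "\<dots> = (\<Sum>e\<in>edges G. \<Sum>v\<in>X. of_bool (v \<in> e))" by (rule sum.swap)
  also have "\<dots> = (\<Sum>e\<in>edges G. card (e \<inter> X))" using fX by (simp add: Int_commute)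
  also have "\<dots> \<le> (\<Sum>e\<in>edges G. 2 * of_bool (?in e) + of_bool (?out e))"
    by (intro sum_mono per_edge)
  also have "\<dots> = 2 * (\<Sum>e\<in>edges G. of_bool (?in e)) + (\<Sum>e\<in>edges G. of_bool (?out e))"
    by (simp only: sum.distrib sum_distrib_left)
  also have "\<dots> = 2 * num_edges (induced_subgraph G X) + card {e \<in> edges G. ?out e}"
    unfolding num_edges_def induced_subgraph_def using fE by (simp add: Int_def)
  finally show ?thesis .
qed

section \<open>Colours repeated at a vertex\<close>

lemma color_class_degree:
  "vertex_degree (color_class G c i) v = card {e \<in> edges G. c e = i \<and> v \<in> e}"
  unfolding vertex_degree_def color_class_def by (simp add: conj_assoc)

lemma repeated_color_degree:
  assumes col: "mod_coloring k G c" and v: "v \<in> verts G"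
    and rep: "vertex_degree (color_class G c i) v > 1"
  shows "vertex_degree (color_class G c i) v \<ge> k + 1"
proof -
  let ?d = "vertex_degree (color_class G c i) v"
  have "[?d = 1] (mod k)" using col v rep unfolding mod_coloring_def by auto
  then have "k dvd ?d - 1" using rep by (simp add: cong_altdef_nat)
  then have "k \<le> ?d - 1" using rep by (intro dvd_imp_le) auto
  then show ?thesis using rep by simp
qed

lemma no_repeated_color:
  assumes G: "simple_graph G" and col: "mod_coloring k G c" and v: "v \<in> verts G"
    and deg: "vertex_degree G v \<le> k"
  shows "vertex_degree (color_class G c i) v \<le> 1"
proof (rule ccontr)
  assume "\<not> ?thesis"
  then have "k + 1 \<le> vertex_degree (color_class G c i) v"
    using repeated_color_degree[OF col v] by simp
  also have "\<dots> \<le> vertex_degree G v"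
    unfolding color_class_degree unfolding vertex_degree_def
    using simple_graph_finite_edges[OF G] by (intro card_mono) auto
  finally show False using deg by simp
qed

lemma repeated_color_unique:
  assumes G: "simple_graph G" and col: "mod_coloring k G c" and v: "v \<in> verts G"
    and deg: "vertex_degree G v \<le> 2 * k + 1"
    and i: "vertex_degree (color_class G c i) v > 1"
    and j: "vertex_degree (color_class G c j) v > 1"
  shows "i = j"
proof (rule ccontr)
  assume ne: "i \<noteq> j"
  have fE: "finite (edges G)" using simple_graph_finite_edges[OF G] .
  let ?E = "\<lambda>i. {e \<in> edges G. c e = i \<and> v \<in> e}"
  have "2 * k + 2 \<le> card (?E i) + card (?E j)"
    using repeated_color_degree[OF col v i] repeated_color_degree[OF col v j]
    unfolding color_class_degree by simp
  also have "\<dots> = card (?E i \<union> ?E j)" using fE ne by (intro card_Un_disjoint[symmetric]) auto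
  also have "\<dots> \<le> vertex_degree G v"
    unfolding vertex_degree_def using fE by (intro card_mono) auto
  finally show False using deg by simp
qed

section \<open>The number of colours\<close>

text \<open>
  A colour repeated at a vertex of \<open>A\<close> may have up to \<open>\<bar>Y\<bar>\<close> rather than \<open>\<bar>X\<bar>\<close> edges across the
  partition; as there are at most \<open>\<bar>A\<bar>\<close> such colours, the total gain over \<open>\<bar>X\<bar>\<close> edges per colour
  is the last summand.
\<close>

lemma degree_sum_le_colors:
  assumes G: "simple_graph G" and col: "mod_coloring k G c"
    and V: "verts G = X \<union> Y" and XY: "card X \<le> card Y" and A: "A \<subseteq> X"
    and degA: "\<And>v. v \<in> A \<Longrightarrow> vertex_degree G v \<le> 2 * k + 1"
    and deg: "\<And>v. v \<in> verts G - A \<Longrightarrow> vertex_degree G v \<le> k"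
    and disj: "X \<inter> Y = {}"
  shows "(\<Sum>v\<in>X. vertex_degree G v) \<le> 2 * num_edges (induced_subgraph G X)
    + card (c ` edges G) * card X + card A * (card Y - card X)"
proof -
  have fE: "finite (edges G)" using simple_graph_finite_edges[OF G] .
  have fin: "finite X" "finite Y" "finite A"
    using G V A unfolding simple_graph_def by (auto intro: finite_subset)
  let ?d = "\<lambda>i v. vertex_degree (color_class G c i) v"
  let ?C = "c ` edges G"
  define B where "B = {e \<in> edges G. e \<inter> X \<noteq> {} \<and> \<not> e \<subseteq> X}"
  define rep where "rep = (\<lambda>v. {i \<in> ?C. ?d i v > 1})"
  define M where "M = (\<Union>v\<in>A. rep v)"
  have single: "?d i v \<le> 1" if "v \<in> verts G - A" for i v
    using no_repeated_color[OF G col _ deg[OF that]] that by blast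
  have "card (rep v) \<le> 1" if "v \<in> A" for v
  proof -
    have "v \<in> verts G" using that A V by blast
    then show ?thesis
      using repeated_color_unique[OF G col _ degA[OF that]] fE
      unfolding rep_def by (auto simp: card_le_Suc0_iff_eq)
  qed
  then have "(\<Sum>v\<in>A. card (rep v)) \<le> (\<Sum>v\<in>A. 1)" by (rule sum_mono)
  then have cM: "card M \<le> card A" using card_UN_le[OF fin(3), of rep] unfolding M_def by simp

  have class_mono: "card {e \<in> {e \<in> B. c e = i}. v \<in> e} \<le> ?d i v" for i v
    unfolding color_class_degree B_def using fE by (intro card_mono) auto
  have cY: "card {e \<in> B. c e = i} \<le> card Y" for i
  proof (rule card_le_of_meets[OF fin(2)])
    show "e \<inter> Y \<noteq> {}" if "e \<in> {e \<in> B. c e = i}" for e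
      using that G V unfolding B_def simple_graph_def by blast
    show "card {e \<in> {e \<in> B. c e = i}. v \<in> e} \<le> 1" if "v \<in> Y" for v
      using that A V disj by (intro order.trans[OF class_mono single]) auto
  qed
  have cX: "card {e \<in> B. c e = i} \<le> card X" if i: "i \<in> ?C - M" for i
  proof (rule card_le_of_meets[OF fin(1)])
    show "e \<inter> X \<noteq> {}" if "e \<in> {e \<in> B. c e = i}" for e
      using that unfolding B_def by blast
    show "card {e \<in> {e \<in> B. c e = i}. v \<in> e} \<le> 1" if "v \<in> X" for v
    proof (rule order.trans[OF class_mono])
      show "?d i v \<le> 1"
      proof (cases "v \<in> A")
        case True
        then show ?thesis using i unfolding M_def rep_def by force
      next
        case False
        then show ?thesis using that V by (intro single) auto
      qed
    qed
  qed
  have "B = (\<Union>i\<in>?C. {e \<in> B. c e = i})" unfolding B_def by blast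
  then have "card B \<le> (\<Sum>i\<in>?C. card {e \<in> B. c e = i})"
    using card_UN_le[of ?C "\<lambda>i. {e \<in> B. c e = i}"] fE by simp
  also have "\<dots> \<le> (\<Sum>i\<in>?C. card X + (if i \<in> M then card Y - card X else 0))"
    using cX cY XY by (intro sum_mono) auto
  also have "\<dots> = card ?C * card X + card (?C \<inter> M) * (card Y - card X)"
    using fE by (simp add: sum.distrib sum.If_cases)
  also have "?C \<inter> M = M" unfolding M_def rep_def by blast
  also have "card ?C * card X + card M * (card Y - card X)
      \<le> card ?C * card X + card A * (card Y - card X)"
    using cM by simp
  finally show ?thesis
    using degree_sum_le[OF G, of X] V unfolding B_def by simp
qed

text \<open>
  The minimum that defines the index is attained because some colouring exists: under an injective
  one every colour class is a single edge.
\<close>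

lemma optimal_mod_coloring:
  assumes "simple_graph G"
  obtains c where "mod_coloring k G c" "card (c ` edges G) = mod_chromatic_index k G"
proof -
  have fE: "finite (edges G)" using simple_graph_finite_edges[OF assms] .
  obtain c :: "'a set \<Rightarrow> nat" where c: "inj_on c (edges G)"
    using finite_imp_inj_to_nat_seg[OF fE] by blast
  have "card {e \<in> edges G. c e = i \<and> v \<in> e} \<le> 1" for i v
    using fE c by (auto simp: card_le_Suc0_iff_eq inj_on_def)
  then have "mod_coloring k G c"
    unfolding mod_coloring_def color_class_degree
    by (metis (no_types, lifting) One_nat_def cong_refl le_SucE le_zero_eq)
  then have "\<exists>m c. mod_coloring k G c \<and> card (c ` edges G) = m" by blast
  then have "\<exists>c. mod_coloring k G c \<and> card (c ` edges G) = mod_chromatic_index k G"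
    unfolding mod_chromatic_index_def by (rule LeastI_ex)
  then show thesis using that by blast
qed

lemma mod_chromatic_index_lower_bound:
  assumes G: "simple_graph G" and V: "verts G = X \<union> Y" "X \<inter> Y = {}"
    and card: "card X = 2 * k - t" "card Y = 2 * k" "A \<subseteq> X" "card A = t" and t: "t \<le> k"
    and degA: "\<And>v. v \<in> A \<Longrightarrow> vertex_degree G v = 2 * k"
    and deg: "\<And>v. v \<in> verts G - A \<Longrightarrow> vertex_degree G v = k"
  shows "2 * (real k)\<^sup>2 \<le> 2 * real (num_edges (induced_subgraph G X))
    + real (mod_chromatic_index k G) * (2 * real k - real t) + (real t)\<^sup>2"
proof -
  obtain c where c: "mod_coloring k G c" "card (c ` edges G) = mod_chromatic_index k G"
    using optimal_mod_coloring[OF G] .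
  have fX: "finite X" using G V unfolding simple_graph_def by simp
  have "(\<Sum>v\<in>X. vertex_degree G v) =
      (\<Sum>v\<in>X - A. vertex_degree G v) + (\<Sum>v\<in>A. vertex_degree G v)"
    using sum.subset_diff[OF card(3) fX] .
  also have "\<dots> = (\<Sum>v\<in>X - A. k) + (\<Sum>v\<in>A. 2 * k)"
    using degA deg V by (intro arg_cong2[where f = "(+)"] sum.cong) auto
  also have "\<dots> = (2 * k - t - t) * k + t * (2 * k)"
    using card card_Diff_subset[of A X] fX by (simp add: finite_subset)
  also have "\<dots> = 2 * k\<^sup>2"
  proof -
    have "(2 * k - t - t) * k + t * (2 * k) = (2 * k - t - t + 2 * t) * k"
      by (simp only: add_mult_distrib mult.assoc mult.left_commute)
    then show ?thesis using t by (simp add: power2_eq_square)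
  qed
  finally have "2 * k\<^sup>2 \<le> 2 * num_edges (induced_subgraph G X)
      + mod_chromatic_index k G * (2 * k - t) + t * t"
    using degree_sum_le_colors[OF G c(1) V(1) _ card(3) _ _ V(2)] card t degA deg c(2) by simp
  then have "real (2 * k\<^sup>2) \<le> real (2 * num_edges (induced_subgraph G X)
      + mod_chromatic_index k G * (2 * k - t) + t * t)"
    by (rule of_nat_mono)
  then show ?thesis using t by (simp add: of_nat_diff power2_eq_square)
qed

section \<open>Asymptotics\<close>

lemma floor_ratio_tendsto:
  fixes a :: real assumes "a \<ge> 0"
  shows "(\<lambda>k. real (nat \<lfloor>a * real k\<rfloor>) / real k) \<longlonglongrightarrow> a"
proof (rule tendsto_sandwich)
  show "\<forall>\<^sub>F k in sequentially. a - 1 / real k \<le> real (nat \<lfloor>a * real k\<rfloor>) / real k"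
    using eventually_gt_at_top[of 0]
  proof eventually_elim
    case (elim k)
    have "(a * real k - 1) / real k \<le> real (nat \<lfloor>a * real k\<rfloor>) / real k"
      by (intro divide_right_mono) linarith+
    then show ?case using elim by (simp add: diff_divide_distrib)
  qed
  show "\<forall>\<^sub>F k in sequentially. real (nat \<lfloor>a * real k\<rfloor>) / real k \<le> a"
    using eventually_gt_at_top[of 0]
  proof eventually_elim
    case (elim k)
    have "real (nat \<lfloor>a * real k\<rfloor>) \<le> a * real k" using assms by simp
    then show ?case using elim by (simp add: field_simps)
  qed
  show "(\<lambda>k. a - 1 / real k) \<longlonglongrightarrow> a"
    using tendsto_diff[OF tendsto_const lim_1_over_n, of a] by simp
qed simp

lemma color_ratio_tendsto:
  fixes t x :: "nat \<Rightarrow> real"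
  assumes t: "(\<lambda>k. t k / real k) \<longlonglongrightarrow> 2 - sqrt 2" and x: "x \<in> o(\<lambda>k. (real k)\<^sup>2)"
  shows "(\<lambda>k. (2 * (real k)\<^sup>2 - 2 * x k - (t k)\<^sup>2) / ((2 * real k - t k) * real k))
    \<longlonglongrightarrow> 4 - 2 * sqrt 2"
proof -
  have "(\<lambda>k. x k / (real k)\<^sup>2) \<longlonglongrightarrow> 0" using smalloD_tendsto[OF x] .
  then have "(\<lambda>k. (2 - 2 * (x k / (real k)\<^sup>2) - (t k / real k)\<^sup>2) / (2 - t k / real k))
      \<longlonglongrightarrow> (2 - 2 * 0 - (2 - sqrt 2)\<^sup>2) / (2 - (2 - sqrt 2))"
    by (intro tendsto_intros t) auto
  also have "(2 - 2 * 0 - (2 - sqrt 2)\<^sup>2) / (2 - (2 - sqrt 2)) = 4 - 2 * sqrt (2::real)"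
    by (simp add: field_simps power2_eq_square)
  finally show ?thesis
  proof (rule Lim_transform_eventually)
    show "\<forall>\<^sub>F k in sequentially. (2 - 2 * (x k / (real k)\<^sup>2) - (t k / real k)\<^sup>2) / (2 - t k / real k)
        = (2 * (real k)\<^sup>2 - 2 * x k - (t k)\<^sup>2) / ((2 * real k - t k) * real k)"
      using eventually_gt_at_top[of 0]
    proof eventually_elim
      case (elim k)
      have num: "2 - 2 * (x k / (real k)\<^sup>2) - (t k / real k)\<^sup>2
          = (2 * (real k)\<^sup>2 - 2 * x k - (t k)\<^sup>2) / (real k)\<^sup>2"
        using elim by (simp add: diff_divide_distrib power_divide)
      have den: "2 - t k / real k = (2 * real k - t k) * real k / (real k)\<^sup>2"
        using elim by (simp add: diff_divide_distrib power2_eq_square)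
      show ?case unfolding num den using elim by simp
    qed
  qed
qed

theorem theorem1p3:
  "\<exists>t :: nat \<Rightarrow> nat.
     (\<forall>k\<ge>2. 1 \<le> t k \<and> t k \<le> k - 1) \<and>
     (\<forall>(G :: nat \<Rightarrow> 'a ugraph) X Y A.
        (\<forall>k\<ge>2.
           simple_graph (G k) \<and>
           verts (G k) = X k \<union> Y k \<and> X k \<inter> Y k = {} \<and>
           card (X k) = 2 * k - t k \<and> card (Y k) = 2 * k \<and>
           A k \<subseteq> X k \<and> card (A k) = t k \<and>
           (\<forall>v\<in>A k. vertex_degree (G k) v = 2 * k) \<and>
           (\<forall>v\<in>verts (G k) - A k. vertex_degree (G k) v = k)) \<longrightarrow>
        (\<lambda>k. real (num_edges (induced_subgraph (G k) (X k)))) \<in> o(\<lambda>k. (real k)\<^sup>2) \<longrightarrow>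
        (\<exists>\<epsilon> :: nat \<Rightarrow> real. \<epsilon> \<longlonglongrightarrow> 0 \<and>
           (\<forall>k\<ge>2. real (mod_chromatic_index k (G k)) \<ge> (4 - 2 * sqrt 2 + \<epsilon> k) * real k)))"
proof -
  define t where "t = (\<lambda>k. nat \<lfloor>(2 - sqrt 2) * real k\<rfloor>)"
  have sqrt2: "4 / 3 \<le> sqrt 2" "sqrt 2 \<le> 3 / (2::real)"
    by (rule real_le_rsqrt, simp add: power2_eq_square)
       (rule real_le_lsqrt, simp_all add: power2_eq_square)
  have t_range: "1 \<le> t k \<and> t k \<le> k - 1" if "k \<ge> 2" for k
  proof
    have "1 / 2 * real k \<le> (2 - sqrt 2) * real k" using sqrt2 by (intro mult_right_mono) auto
    then show "1 \<le> t k" using that unfolding t_def by linarith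
    have "(2 - sqrt 2) * real k \<le> 2 / 3 * real k" using sqrt2 by (intro mult_right_mono) auto
    \<comment> \<open>The integrality of the floor matters here: \<open>2 k / 3\<close> exceeds \<open>k - 1\<close> for \<open>k = 2\<close>.\<close>
    also have "\<dots> < real k" using that by simp
    finally have "\<lfloor>(2 - sqrt 2) * real k\<rfloor> < int k" by (simp add: floor_less_iff)
    then have "t k < k" using that unfolding t_def by linarith
    then show "t k \<le> k - 1" by simp
  qed
  show ?thesis
  proof (intro exI[of _ t] conjI allI impI)
    fix k :: nat assume "k \<ge> 2"
    then show "1 \<le> t k" "t k \<le> k - 1" using t_range by auto
  next
    fix G :: "nat \<Rightarrow> 'a ugraph" and X Y A :: "nat \<Rightarrow> 'a set"
    assume H: "\<forall>k\<ge>2. simple_graph (G k) \<and>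
           verts (G k) = X k \<union> Y k \<and> X k \<inter> Y k = {} \<and>
           card (X k) = 2 * k - t k \<and> card (Y k) = 2 * k \<and>
           A k \<subseteq> X k \<and> card (A k) = t k \<and>
           (\<forall>v\<in>A k. vertex_degree (G k) v = 2 * k) \<and>
           (\<forall>v\<in>verts (G k) - A k. vertex_degree (G k) v = k)"
    let ?x = "\<lambda>k. real (num_edges (induced_subgraph (G k) (X k)))"
    let ?q = "\<lambda>k. (2 * (real k)\<^sup>2 - 2 * ?x k - (real (t k))\<^sup>2)
      / ((2 * real k - real (t k)) * real k)"
    assume small: "?x \<in> o(\<lambda>k. (real k)\<^sup>2)"
    have "(\<lambda>k. real (t k) / real k) \<longlonglongrightarrow> 2 - sqrt 2"
      unfolding t_def using sqrt2 by (intro floor_ratio_tendsto) auto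
    then have "?q \<longlonglongrightarrow> 4 - 2 * sqrt 2" using small by (rule color_ratio_tendsto)
    then have "(\<lambda>k. ?q k - (4 - 2 * sqrt 2)) \<longlonglongrightarrow> 0" by (simp add: LIM_zero)
    moreover have "?q k * real k \<le> real (mod_chromatic_index k (G k))" if k: "k \<ge> 2" for k
    proof -
      have tk: "t k \<le> k" "t k < 2 * k" using t_range[OF k] k by linarith+
      have "2 * (real k)\<^sup>2 - 2 * ?x k - (real (t k))\<^sup>2
          \<le> real (mod_chromatic_index k (G k)) * (2 * real k - real (t k))"
        using mod_chromatic_index_lower_bound[of "G k" "X k" "Y k" k "t k" "A k"] H k tk by simp
      then show ?thesis using k tk by (simp add: divide_le_eq)
    qed
    ultimately show "\<exists>\<epsilon> :: nat \<Rightarrow> real. \<epsilon> \<longlonglongrightarrow> 0 \<and>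
        (\<forall>k\<ge>2. real (mod_chromatic_index k (G k)) \<ge> (4 - 2 * sqrt 2 + \<epsilon> k) * real k)"
      by (intro exI[of _ "\<lambda>k. ?q k - (4 - 2 * sqrt 2)"]) auto
  qed
qed

end
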